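(* Let $K$ be a field of characteristic $0$, let $r\ge1$, $H(x,y)\in K[[x,y]]$, and suppose that $Y_1,\dots,Y_r\in K[[x^{1/N}]]$ (for some $N\ge1$) are $r$ distinct positive roots of $y^r-xH(x,y)$. Then for every $\Phi(x,y)\in K[[x,y]]$, $$\mathop{\mathrm{CT}}_y\ \frac{y}{y^r-xH(x,y)}\,\Phi(x,y)=\sum_{i=1}^r\left.\frac{\Phi(x,y)}{r\,y^{r-1}-x\frac{\partial}{\partial y}H(x,y)}\right|_{y=Y_i},$$ where the reciprocal on the left is computed in the field $K((y))((x))$.
   Context: A positive root of $G(x,y)\in K[[x,y]]$ is a fractional power series $Y(x)\in\bigcup_{N\ge1}K[[x^{1/N}]]$ with zero constant term such that $G(x,Y(x))=0$. $K((y))((x))$ is the field of Laurent series in $x$ with coefficients in $K((y))$; for $f=\sum_na_n(y)x^n$ in it, $\mathrm{CT}_yf=\sum_n([y^0]a_n(y))x^n$. *)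

theory Defs
  imports "HOL-Computational_Algebra.Computational_Algebra"
begin

text \<open>
  \<open>K[[x,y]]\<close> is encoded as \<open>'a fps fps\<close> and \<open>K((y))((x))\<close> as \<open>'a fls fls\<close>; in both cases the
  outer variable is \<open>x\<close> and the coefficients are series in \<open>y\<close>.  For fixed \<open>N \<ge> 1\<close>, elements of
  \<open>K[[x^{1/N}]]\<close> and \<open>K((x^{1/N}))\<close> are encoded as \<open>'a fps\<close> and \<open>'a fls\<close> in the variable
  \<open>t = x^{1/N}\<close>, so that \<open>x\<close> becomes \<open>t^N\<close>.
\<close>

abbreviation var_x :: "'a::comm_ring_1 fps fps"
  where "var_x \<equiv> fps_X"

abbreviation var_y :: "'a::comm_ring_1 fps fps"
  where "var_y \<equiv> fps_const fps_X"

definition deriv_y :: "'a::comm_ring_1 fps fps \<Rightarrow> 'a fps fps"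
  where "deriv_y G = Abs_fps (\<lambda>n. fps_deriv (fps_nth G n))"

text \<open>
  \<open>subst_xy N Y G\<close> is \<open>G(t^N, Y(t)) = (\<Sum>n. t^(n N) * g\<^sub>n(Y(t)))\<close> for \<open>G = (\<Sum>n. g\<^sub>n(y) x^n)\<close>.
  It is meaningful when \<open>N \<ge> 1\<close> and \<open>Y\<close> has zero constant term; then only the summands with
  \<open>n \<le> k\<close> contribute to the coefficient of \<open>t^k\<close>.
\<close>
definition subst_xy :: "nat \<Rightarrow> 'a::comm_ring_1 fps \<Rightarrow> 'a fps fps \<Rightarrow> 'a fps"
  where "subst_xy N Y G =
    Abs_fps (\<lambda>k. \<Sum>n\<le>k. fps_nth (fps_X ^ (n * N) * fps_compose (fps_nth G n) Y) k)"

lemma fps_nth_subst_xy: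
  assumes "N \<ge> 1" "k \<le> m"
  shows "fps_nth (subst_xy N Y G) k =
    fps_nth (\<Sum>n\<le>m. fps_X ^ (n * N) * fps_compose (fps_nth G n) Y) k"
proof -
  have "fps_nth (fps_X ^ (n * N) * fps_compose (fps_nth G n) Y) k = 0" if "n > k" for n
  proof -
    have "n \<le> n * N" using assms(1) by simp
    then have "n * N > k" using that by (rule less_le_trans[rotated])
    then show ?thesis by (simp add: fps_X_power_mult_nth)
  qed
  then have "(\<Sum>n\<le>k. fps_nth (fps_X ^ (n * N) * fps_compose (fps_nth G n) Y) k) =
      (\<Sum>n\<le>m. fps_nth (fps_X ^ (n * N) * fps_compose (fps_nth G n) Y) k)"
    using assms(2) by (intro sum.mono_neutral_left) auto
  then show ?thesis by (simp add: subst_xy_def fps_sum_nth)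
qed

text \<open>\<open>positive_root N G Y\<close>: the series \<open>Y(x^{1/N})\<close> is a positive root of \<open>G\<close>.\<close>
definition positive_root :: "nat \<Rightarrow> 'a::comm_ring_1 fps fps \<Rightarrow> 'a fps \<Rightarrow> bool"
  where "positive_root N G Y \<longleftrightarrow> fps_nth Y 0 = 0 \<and> subst_xy N Y G = 0"

text \<open>The inclusion of \<open>K[[x,y]]\<close> into \<open>K((y))((x))\<close>.\<close>
definition iter_laurent :: "'a::comm_ring_1 fps fps \<Rightarrow> 'a fls fls"
  where "iter_laurent G = fps_to_fls (Abs_fps (\<lambda>n. fps_to_fls (fps_nth G n)))"

definition CT_y :: "'a::zero fls fls \<Rightarrow> 'a fls"
  where "CT_y f = Abs_fls (\<lambda>n. fls_nth (fls_nth f n) 0)"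

lemma fls_nth_CT_y: "fls_nth (CT_y f) n = fls_nth (fls_nth f n) 0"
proof -
  obtain M where "\<forall>n<M. fls_nth f n = 0" by (rule fls_nth_vanishes_belowE)
  then show ?thesis unfolding CT_y_def by (intro nth_Abs_fls_lower_bound[of M]) simp
qed

end

theory Submission
  imports Defs
begin

text \<open>
  Replacing \<open>x\<close> by \<open>t^N\<close> reduces everything to \<open>N = 1\<close>.  Dividing \<open>G = y^r - x H\<close> successively by the
  linear factors \<open>y - Y\<^sub>i\<close> gives \<open>G = U \<Prod>\<^sub>i (y - Y\<^sub>i)\<close>, and \<open>U\<close> is a unit because both \<open>G\<close> and the
  product reduce to \<open>y^r\<close> at \<open>t = 0\<close>.  Partial fractions then reduce the claim to
  \<open>CT\<^sub>y (y F / (y - Y)) = F(t, Y)\<close>: write \<open>F = (y - Y) Q + F(t, Y)\<close> and expand \<open>y / (y - Y)\<close> as a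
  geometric series in \<open>Y / y\<close>.
\<close>

section \<open>Evaluation\<close>

lemma subst_xy_add: "subst_xy N Y (F + G) = subst_xy N Y F + subst_xy N Y G"
  by (simp add: subst_xy_def fps_eq_iff fps_compose_add_distrib algebra_simps sum.distrib)

lemma subst_xy_diff: "subst_xy N Y (F - G) = subst_xy N Y F - subst_xy N Y G"
  by (metis add_diff_cancel diff_add_cancel subst_xy_add)

text \<open>Composition with \<open>Y\<close> is multiplicative since \<open>Y\<close> has zero
  constant term. The rest is a rearrangement of a double sum, finite in each degree: the term
  \<open>A i * B j\<close> starts at degree (i + j) N, so pairs with i + j > k do not reach the
  coefficient of t^k.\<close>

lemma subst_xy_mult:
  fixes F G :: "'a::idom fps fps"
  assumes "N \<ge> 1" "fps_nth Y 0 = 0"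
  shows "subst_xy N Y (F * G) = subst_xy N Y F * subst_xy N Y G"
proof (rule fps_ext)
  fix k
  define A where "A n = fps_X ^ (n * N) * fps_compose (fps_nth F n) Y" for n
  define B where "B n = fps_X ^ (n * N) * fps_compose (fps_nth G n) Y" for n
  have AB: "A i * B j = fps_X ^ ((i + j) * N) *
      (fps_compose (fps_nth F i) Y * fps_compose (fps_nth G j) Y)" for i j
    by (simp add: A_def B_def algebra_simps power_add)
  have zero: "fps_nth (A i * B j) k = 0" if "i + j > k" for i j
  proof -
    have "(i + j) * 1 \<le> (i + j) * N" using assms(1) by (intro mult_le_mono2)
    then have "k < (i + j) * N" using that by (simp only: mult_1_right)
    then show ?thesis unfolding AB by (simp only: fps_X_power_mult_nth if_True)
  qed
  \<comment> \<open>Truncation at \<open>k\<close> is correct for every coefficient of index at most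
    \<open>k\<close>, so one pair of finite sums serves all terms of the Cauchy product.\<close>
  have "fps_nth (subst_xy N Y F * subst_xy N Y G) k = fps_nth (sum A {..k} * sum B {..k}) k"
    unfolding fps_mult_nth
    by (intro sum.cong refl arg_cong2[where f = "(*)"])
      (simp_all add: A_def B_def fps_nth_subst_xy[OF assms(1), of _ k])
  also have "\<dots> = (\<Sum>(i, j)\<in>{..k} \<times> {..k}. fps_nth (A i * B j) k)"
    by (simp add: sum_product fps_sum_nth flip: sum.cartesian_product)
  also have "\<dots> = (\<Sum>(i, j)\<in>{(i, j). i + j \<le> k}. fps_nth (A i * B j) k)"
    by (intro sum.mono_neutral_right) (auto intro!: zero)
  also have "\<dots> = (\<Sum>n\<le>k. \<Sum>i\<le>n. fps_nth (A i * B (n - i)) k)"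
    by (rule sum.triangle_reindex_eq)
  also have "\<dots> = fps_nth (subst_xy N Y (F * G)) k"
    unfolding subst_xy_def fps_nth_Abs_fps
  proof (intro sum.cong refl)
    fix n assume "n \<in> {..k}"
    have "fps_X ^ (n * N) * fps_compose (fps_nth (F * G) n) Y = (\<Sum>i\<le>n. A i * B (n - i))"
      by (simp add: fps_mult_nth AB fps_compose_sum_distrib fps_compose_mult_distrib[OF assms(2)]
          sum_distrib_left atLeast0AtMost)
    then show "(\<Sum>i\<le>n. fps_nth (A i * B (n - i)) k) =
        fps_nth (fps_X ^ (n * N) * fps_compose (fps_nth (F * G) n) Y) k"
      by (simp add: fps_sum_nth)
  qed
  finally show "fps_nth (subst_xy N Y (F * G)) k = fps_nth (subst_xy N Y F * subst_xy N Y G) k"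
    by simp
qed

text \<open>This moves the ramification from the evaluation into the series: F(t^N, y) is itself a
  power series in t and y, evaluated at y = Y(t).\<close>

lemma subst_xy_eq_subst_xy_1:
  fixes F :: "'a::comm_ring_1 fps fps"
  assumes "N \<ge> 1"
  shows "subst_xy N Y F = subst_xy 1 Y (fps_compose F (fps_X ^ N))"
proof (rule fps_ext)
  fix k
  \<comment> \<open>The bound \<open>k * N\<close> makes room for all exponents n N with n \<le> k;
    the other exponents in this range are no multiples of N and have zero coefficient.\<close>
  have "fps_nth (subst_xy 1 Y (fps_compose F (fps_X ^ N))) k =
      fps_nth (\<Sum>n\<le>k * N. fps_X ^ n * fps_compose (fps_nth (fps_compose F (fps_X ^ N)) n) Y) k"
    using assms by (subst fps_nth_subst_xy[where m = "k * N"]) auto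
  also have "(\<Sum>n\<le>k * N. fps_X ^ n * fps_compose (fps_nth (fps_compose F (fps_X ^ N)) n) Y) =
      (\<Sum>n\<in>(\<lambda>n. n * N) ` {..k}. fps_X ^ n * fps_compose (fps_nth (fps_compose F (fps_X ^ N)) n) Y)"
    using assms by (intro sum.mono_neutral_right) (auto simp: fps_nth_compose_X_power elim!: dvdE)
  also have "\<dots> = (\<Sum>n\<le>k. fps_X ^ (n * N) * fps_compose (fps_nth F n) Y)"
    using assms by (subst sum.reindex) (auto simp: fps_nth_compose_X_power inj_on_def)
  finally show "fps_nth (subst_xy N Y F) k = fps_nth (subst_xy 1 Y (fps_compose F (fps_X ^ N))) k"
    using assms by (simp add: fps_nth_subst_xy[where m = k])
qed

section \<open>Series in the outer variable only\<close>

text \<open>The embedding of K[[t]] as series constant in y; \<open>fps_const\<close> embeds the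
  series in y instead.\<close>

definition outer_const :: "'a::comm_ring_1 fps \<Rightarrow> 'a fps fps"
  where "outer_const f = Abs_fps (\<lambda>n. fps_const (fps_nth f n))"

lemma outer_const_nth [simp]: "fps_nth (outer_const f) n = fps_const (fps_nth f n)"
  by (simp add: outer_const_def)

lemma outer_const_diff: "outer_const (f - g) = outer_const f - outer_const g"
  by (simp add: fps_eq_iff)

lemma outer_const_mult: "outer_const (f * g) = outer_const f * outer_const g"
proof (rule fps_ext)
  have "fps_const (sum h S) = (\<Sum>i\<in>S. fps_const (h i))" for h :: "nat \<Rightarrow> 'a" and S
    by (simp add: fps_eq_iff fps_sum_nth)
  then show "fps_nth (outer_const (f * g)) n = fps_nth (outer_const f * outer_const g) n" for n
    by (simp add: fps_mult_nth)
qed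

lemma outer_const_1 [simp]: "outer_const 1 = 1"
  by (rule fps_ext) simp

lemma outer_const_prod: "outer_const (prod f S) = (\<Prod>i\<in>S. outer_const (f i))"
  by (induction S rule: infinite_finite_induct) (simp_all add: outer_const_mult)

lemma outer_const_eq_0_iff [simp]: "outer_const f = 0 \<longleftrightarrow> f = 0"
  by (simp add: fps_eq_iff[of _ 0])

lemma subst_xy_outer_const: "subst_xy 1 Y (outer_const f) = f"
proof (rule fps_ext)
  fix k
  have "fps_nth (subst_xy 1 Y (outer_const f)) k = (\<Sum>n\<le>k. if n = k then fps_nth f k else 0)"
    unfolding subst_xy_def fps_nth_Abs_fps
    by (intro sum.cong refl) (auto simp: fps_X_power_mult_nth)
  then show "fps_nth (subst_xy 1 Y (outer_const f)) k = fps_nth f k"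
    by simp
qed

lemma subst_xy_const:
  fixes Y :: "'a::comm_ring_1 fps"
  assumes "N \<ge> 1"
  shows "subst_xy N Y (fps_const g) = fps_compose g Y"
proof (rule fps_ext)
  fix k
  have "fps_nth (subst_xy N Y (fps_const g)) k =
      (\<Sum>n\<le>k. if n = 0 then fps_nth (fps_compose g Y) k else 0)"
    unfolding subst_xy_def fps_nth_Abs_fps
    by (intro sum.cong refl) (auto simp: fps_X_power_mult_nth)
  then show "fps_nth (subst_xy N Y (fps_const g)) k = fps_nth (fps_compose g Y) k"
    by simp
qed

lemma subst_xy_1 [simp]: "subst_xy 1 Y 1 = 1"
  using subst_xy_outer_const[of Y 1] by simp

lemma subst_xy_prod:
  fixes F :: "'b \<Rightarrow> 'a::idom fps fps"
  assumes "fps_nth Y 0 = 0"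
  shows "subst_xy 1 Y (prod F S) = (\<Prod>i\<in>S. subst_xy 1 Y (F i))"
  using subst_xy_1[of Y]
  by (induction S rule: infinite_finite_induct) (simp_all add: subst_xy_mult[OF _ assms])

section \<open>Linear factors\<close>

definition root_factor :: "'a::comm_ring_1 fps \<Rightarrow> 'a fps fps"
  where "root_factor Y = var_y - outer_const Y"

lemma root_factor_nonzero: "root_factor Y \<noteq> 0"
proof
  assume "root_factor Y = 0"
  then have "fps_nth (fps_nth (root_factor Y) 0) 1 = 0" by simp
  then show False by (simp add: root_factor_def)
qed

lemma subst_xy_root_factor:
  assumes "fps_nth Y 0 = 0"
  shows "subst_xy 1 Y (root_factor Z) = Y - Z"
  using assms by (simp add: root_factor_def subst_xy_diff subst_xy_const subst_xy_outer_const[simplified])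

text \<open>Synthetic division. \<open>shift a\<close> is F with the terms below y^a dropped,
  divided by y^a, and \<open>T a\<close> is its value at \<open>Y\<close>. The Horner recursion
  \<open>T_Suc\<close> makes the product with y - Y telescope.\<close>

lemma root_factor_division:
  fixes F :: "'a::idom fps fps"
  assumes Y: "fps_nth Y 0 = 0"
  obtains Q where "F = root_factor Y * Q + outer_const (subst_xy 1 Y F)"
proof -
  define shift where "shift a = Abs_fps (\<lambda>n. fps_shift a (fps_nth F n))" for a
  define T where "T a = subst_xy 1 Y (shift a)" for a
  \<comment> \<open>Comparing powers of \<open>y\<close>, the coefficient of \<open>y^a\<close> in the quotient has to be \<open>T (a + 1)\<close>.\<close>
  define Q where "Q = Abs_fps (\<lambda>n. Abs_fps (\<lambda>a. fps_nth (T (Suc a)) n))"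
  have T_Suc: "Y * T (Suc a) = T a - Abs_fps (\<lambda>n. fps_nth (fps_nth F n) a)" for a
  proof -
    have "var_y * shift (Suc a) = shift a - outer_const (Abs_fps (\<lambda>n. fps_nth (fps_nth F n) a))"
    proof (intro fps_ext)
      fix n m
      show "fps_nth (fps_nth (var_y * shift (Suc a)) n) m = fps_nth (fps_nth
          (shift a - outer_const (Abs_fps (\<lambda>n. fps_nth (fps_nth F n) a))) n) m"
        by (cases m) (simp_all add: shift_def)
    qed
    then have "subst_xy 1 Y (var_y * shift (Suc a)) = 
        T a - Abs_fps (\<lambda>n. fps_nth (fps_nth F n) a)"
      by (simp only: subst_xy_diff T_def subst_xy_outer_const)
    then show ?thesis
      by (simp add: subst_xy_mult[OF _ Y] subst_xy_const fps_X_fps_compose_startby0[OF Y] T_def)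
  qed
  have Q: "fps_nth (fps_nth (outer_const Y * Q) n) a = fps_nth (Y * T (Suc a)) n" for n a
    by (simp add: fps_mult_nth[of Y] fps_mult_nth[of "outer_const Y"] Q_def fps_sum_nth)
  have "F = root_factor Y * Q + outer_const (subst_xy 1 Y F)"
  proof (intro fps_ext)
    fix n a
    have "shift 0 = F" by (simp add: shift_def fps_eq_iff)
    \<comment> \<open>In degree a > 0 the recursion leaves \<open>T a\<close> minus Y
      \<open>T (Suc a)\<close>, the coefficient of y^a in F. In degree 0 the term y Q is absent, and
      the remainder \<open>T 0\<close>, the value of F at \<open>Y\<close>, takes its place.\<close>
    then show "fps_nth (fps_nth F n) a =
        fps_nth (fps_nth (root_factor Y * Q + outer_const (subst_xy 1 Y F)) n) a"
      by (cases a) (simp_all add: root_factor_def left_diff_distrib Q T_Suc, simp_all add: Q_def T_def)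
  qed
  then show thesis by (rule that)
qed

lemma root_factor_dvd:
  fixes F :: "'a::idom fps fps"
  assumes "fps_nth Y 0 = 0" "subst_xy 1 Y F = 0"
  shows "root_factor Y dvd F"
proof -
  obtain Q where "F = root_factor Y * Q + outer_const (subst_xy 1 Y F)"
    using root_factor_division[OF assms(1)] .
  moreover have "outer_const (subst_xy 1 Y F) = 0" by (simp only: assms(2) outer_const_eq_0_iff)
  ultimately show ?thesis by (metis add.right_neutral dvd_triv_left)
qed

text \<open>Once the factors over \<open>S\<close> are split off, evaluation at the new root makes
  their product a nonzero element of the domain K[[t]], because the roots are distinct. Hence the
  cofactor vanishes there and the new factor divides it.\<close>

lemma prod_root_factor_dvd:
  fixes F :: "'a::idom fps fps"
  assumes "finite S" "inj_on Y S"
    and "\<And>i. i \<in> S \<Longrightarrow> fps_nth (Y i) 0 = 0" "\<And>i. i \<in> S \<Longrightarrow> subst_xy 1 (Y i) F = 0"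
  shows "(\<Prod>i\<in>S. root_factor (Y i)) dvd F"
  using assms
proof (induction S)
  case (insert a S)
  then obtain U where U: "F = (\<Prod>i\<in>S. root_factor (Y i)) * U"
    by (auto elim!: dvdE)
  have "subst_xy 1 (Y a) F = (\<Prod>i\<in>S. Y a - Y i) * subst_xy 1 (Y a) U"
    using insert.prems by (simp only: U subst_xy_mult subst_xy_prod subst_xy_root_factor insertI1)
  then have "(\<Prod>i\<in>S. Y a - Y i) * subst_xy 1 (Y a) U = 0"
    using insert.prems by simp
  moreover have "(\<Prod>i\<in>S. Y a - Y i) \<noteq> 0"
    using insert.hyps insert.prems by (auto simp: inj_on_def)
  ultimately have "root_factor (Y a) dvd U"
    using insert.prems by (intro root_factor_dvd) auto
  then show ?case using insert.hyps by (simp add: U mult.commute mult_dvd_mono)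
qed simp

section \<open>Derivatives\<close>

lemma deriv_y_nth [simp]: "fps_nth (deriv_y F) n = fps_deriv (fps_nth F n)"
  by (simp add: deriv_y_def)

lemma deriv_y_mult: "deriv_y (F * G) = deriv_y F * G + F * deriv_y G"
proof (rule fps_ext)
  have "fps_deriv (sum h S) = (\<Sum>i\<in>S. fps_deriv (h i))" for h :: "nat \<Rightarrow> 'a fps" and S
    by (induction S rule: infinite_finite_induct) simp_all
  then show "fps_nth (deriv_y (F * G)) n = fps_nth (deriv_y F * G + F * deriv_y G) n" for n
    by (simp add: fps_mult_nth sum.distrib add.commute)
qed

lemma deriv_y_root_factor [simp]: "deriv_y (root_factor Y) = 1"
  by (rule fps_ext) (simp add: root_factor_def fps_eq_iff)

text \<open>In the product rule the undifferentiated factor y - Y vanishes at \<open>Y\<close>, and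
  its derivative is 1.\<close>

lemma subst_xy_deriv_y_root:
  fixes Q :: "'a::idom fps fps"
  assumes "fps_nth Y 0 = 0"
  shows "subst_xy 1 Y (deriv_y (root_factor Y * Q)) = subst_xy 1 Y Q"
  by (simp add: deriv_y_mult subst_xy_add subst_xy_mult assms subst_xy_root_factor[simplified])

section \<open>Constant terms\<close>

lemma iter_laurent_nth: "fls_nth (iter_laurent F) n = (if n < 0 then 0 else fps_to_fls (fps_nth F (nat n)))"
  by (simp add: iter_laurent_def)

lemma iter_laurent_add: "iter_laurent (F + G) = iter_laurent F + iter_laurent G"
  by (rule fls_eqI) (simp add: iter_laurent_nth)

lemma iter_laurent_diff: "iter_laurent (F - G) = iter_laurent F - iter_laurent G"
  by (rule fls_eqI) (simp add: iter_laurent_nth)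

lemma iter_laurent_mult: "iter_laurent (F * G) = iter_laurent F * iter_laurent G"
proof -
  have sum: "fps_to_fls (sum h S) = (\<Sum>i\<in>S. fps_to_fls (h i))" for h :: "nat \<Rightarrow> 'a fps" and S
    by (induction S rule: infinite_finite_induct) simp_all
  have "Abs_fps (\<lambda>n. fps_to_fls (fps_nth (F * G) n)) =
      Abs_fps (\<lambda>n. fps_to_fls (fps_nth F n)) * Abs_fps (\<lambda>n. fps_to_fls (fps_nth G n))"
    by (rule fps_ext) (simp add: fps_mult_nth sum fls_times_fps_to_fls)
  then show ?thesis by (simp add: iter_laurent_def fls_times_fps_to_fls)
qed

lemma iter_laurent_1 [simp]: "iter_laurent 1 = 1"
  by (rule fls_eqI) (auto simp: iter_laurent_nth)

lemma iter_laurent_prod: "iter_laurent (prod F S) = (\<Prod>i\<in>S. iter_laurent (F i))"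
  by (induction S rule: infinite_finite_induct) (simp_all add: iter_laurent_mult)

lemma iter_laurent_eq_0_iff [simp]: "iter_laurent F = 0 \<longleftrightarrow> F = 0"
  by (auto simp: iter_laurent_def fps_eq_iff[of _ 0])

lemma CT_y_add: "CT_y (f + g) = CT_y f + CT_y g"
  by (rule fls_eqI) (simp add: fls_nth_CT_y)

lemma CT_y_0 [simp]: "CT_y 0 = 0"
  by (rule fls_eqI) (simp add: fls_nth_CT_y)

lemma CT_y_sum: "CT_y (sum f S) = (\<Sum>i\<in>S. CT_y (f i))"
  by (induction S rule: infinite_finite_induct) (simp_all add: CT_y_add)

text \<open>Coefficientwise, \<open>c\<close> multiplies by scalars of K, which commute with taking
  the coefficient of y^0.\<close>

lemma CT_y_outer_const_mult:
  fixes g :: "'a::comm_ring_1 fls fls"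
  shows "CT_y (iter_laurent (outer_const c) * g) = fps_to_fls c * CT_y g"
proof -
  \<comment> \<open>A shift in the outer variable makes \<open>g\<close> a power series, so that the
    product becomes a finite convolution in each degree.\<close>
  obtain m :: int and h where g: "g = fls_shift m (fps_to_fls h)"
    using fls_as_fps[of g "- fls_subdegree g"] by (metis order.refl)
  have shift: "CT_y (fls_shift m f) = fls_shift m (CT_y f)" for f :: "'a fls fls"
    by (rule fls_eqI) (simp add: fls_nth_CT_y)
  have fps: "CT_y (fps_to_fls f) = fps_to_fls (Abs_fps (\<lambda>n. fls_nth (fps_nth f n) 0))"
    for f :: "'a fls fps"
    by (rule fls_eqI) (simp add: fls_nth_CT_y)
  have "Abs_fps (\<lambda>n. fls_nth (fps_nth (Abs_fps (\<lambda>n. fps_to_fls (fps_nth (outer_const c) n)) * h) n) 0) =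
      c * Abs_fps (\<lambda>n. fls_nth (fps_nth h n) 0)"
    by (rule fps_ext) (simp add: fps_mult_nth fls_nth_sum)
  then show ?thesis
    by (simp add: g iter_laurent_def fls_shifted_times_simps shift fps flip: fls_times_fps_to_fls)
qed

text \<open>Multiply back by \<open>c\<close> and use linearity. The division takes place in Laurent
  series fields, so nonunits \<open>c\<close> of K[[t]] are covered.\<close>

lemma CT_y_divide_outer_const:
  fixes g :: "'a::field fls fls"
  assumes "c \<noteq> 0"
  shows "CT_y (g / iter_laurent (outer_const c)) = CT_y g / fps_to_fls c"
proof -
  have "fps_to_fls c * CT_y (g / iter_laurent (outer_const c)) = CT_y g"
    using assms by (simp flip: CT_y_outer_const_mult)
  then show ?thesis using assms by (simp add: field_simps)
qed

lemma CT_y_var_y_mult: "CT_y (iter_laurent var_y * iter_laurent F) = 0"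
  by (rule fls_eqI) (simp add: fls_nth_CT_y iter_laurent_nth flip: iter_laurent_mult)

lemma CT_y_geometric:
  fixes Y :: "'a::field fps"
  assumes "fps_nth Y 0 = 0"
  shows "CT_y (iter_laurent var_y / iter_laurent (root_factor Y)) = 1"
proof -
  define W where "W = Abs_fps (\<lambda>n. fls_const (fps_nth Y n) * fls_X_inv)"
  define u where "u = inverse (1 - W)"
  have W0: "fps_nth W 0 = 0" using assms by (simp add: W_def)
  \<comment> \<open>The zero constant term of \<open>Y\<close> makes 1 - W invertible as a power
    series in the outer variable over K((y)).\<close>
  have Wu: "(1 - W) * u = 1"
    unfolding u_def using W0 by (intro inverse_mult_eq_1') simp
  then have u: "u = 1 + W * u" by (simp add: algebra_simps)
  \<comment> \<open>\<open>W\<close> is \<open>Y / y\<close>, so multiplication by it lowers degrees in \<open>y\<close>.\<close>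
  have "\<forall>j\<ge>0. fls_nth (fps_nth u n) j = (if n = 0 \<and> j = 0 then 1 else 0)" for n
  proof (induction n rule: less_induct)
    case (less n)
    show ?case
    proof (intro allI impI)
      fix j :: int assume j: "j \<ge> 0"
      \<comment> \<open>Up to a scalar this is the coefficient of y^(j+1) in an earlier term of
        \<open>u\<close>, which is zero as j + 1 > 0; hence the induction runs over all j \<ge> 0 at
        once.\<close>
      have "fls_nth (fps_nth W i * fps_nth u (n - i)) j = 0" if "i \<le> n" for i
      proof (cases "i = 0")
        case False
        then show ?thesis using less[of "n - i"] j that
          by (simp add: W_def mult.assoc fls_X_inv_times_conv_shift(1))
      qed (simp add: W0)
      then have "fls_nth (fps_nth (W * u) n) j = 0"
        by (simp add: fps_mult_nth fls_nth_sum)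
      then show "fls_nth (fps_nth u n) j = (if n = 0 \<and> j = 0 then 1 else 0)"
        by (subst u) simp
    qed
  qed
  then have CT: "CT_y (fps_to_fls u) = 1"
    by (intro fls_eqI) (auto simp: fls_nth_CT_y)
  have W: "iter_laurent (outer_const Y) = iter_laurent var_y * fps_to_fls W"
  proof -
    have "Abs_fps (\<lambda>n. fps_to_fls (fps_nth (outer_const Y) n)) = fps_const fls_X * W"
      by (rule fps_ext) (simp add: W_def fls_X_times_conv_shift fls_X_inv_times_conv_shift)
    moreover have "Abs_fps (\<lambda>n. fps_to_fls (fps_nth (var_y :: 'a fps fps) n)) = fps_const fls_X"
      by (rule fps_ext) simp
    ultimately show ?thesis by (simp only: iter_laurent_def fls_times_fps_to_fls)
  qed
  have "iter_laurent (root_factor Y) = iter_laurent var_y * fps_to_fls (1 - W)"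
    by (simp add: root_factor_def iter_laurent_diff W algebra_simps)
  then have eq: "iter_laurent (root_factor Y) * fps_to_fls u = iter_laurent var_y"
    using Wu by (simp only: mult.assoc fps_one_to_fls mult_1_right flip: fls_times_fps_to_fls)
  have "iter_laurent var_y / iter_laurent (root_factor Y) = fps_to_fls u"
    using eq by (simp add: root_factor_nonzero field_simps)
  then show ?thesis using CT by simp
qed

lemma CT_y_root_factor:
  fixes Y :: "'a::field fps"
  assumes "fps_nth Y 0 = 0"
  shows "CT_y (iter_laurent var_y / iter_laurent (root_factor Y) * iter_laurent F) =
    fps_to_fls (subst_xy 1 Y F)"
proof -
  obtain Q where "F = root_factor Y * Q + outer_const (subst_xy 1 Y F)"
    using root_factor_division[OF assms] .
  then have F: "iter_laurent F = iter_laurent (root_factor Y) * iter_laurent Q +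
      iter_laurent (outer_const (subst_xy 1 Y F))"
    by (metis iter_laurent_add iter_laurent_mult)
  have "iter_laurent var_y / iter_laurent (root_factor Y) * iter_laurent F =
      iter_laurent var_y * iter_laurent Q + iter_laurent (outer_const (subst_xy 1 Y F)) *
        (iter_laurent var_y / iter_laurent (root_factor Y))"
    unfolding F by (simp add: root_factor_nonzero field_simps)
  then show ?thesis
    by (simp only: CT_y_add CT_y_var_y_mult CT_y_outer_const_mult CT_y_geometric[OF assms]) simp
qed

text \<open>Inserting \<open>a\<close> uses 1/((y - z_i)(z_i - z_a)) = (1/(y - z_i) - 1/(z_a -
  z_i))/(y - z_a). The induction hypothesis is then applied at two points, \<open>y\<close> and
  \<open>z a\<close>, so \<open>y\<close> has to be arbitrary.\<close>

lemma partial_fractions: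
  fixes z :: "'b \<Rightarrow> 'c::field"
  assumes "finite S" "S \<noteq> {}" "inj_on z S" "y \<notin> z ` S"
  shows "1 / (\<Prod>i\<in>S. y - z i) = (\<Sum>i\<in>S. 1 / ((y - z i) * (\<Prod>j\<in>S - {i}. z i - z j)))"
  using assms
proof (induction S arbitrary: y rule: finite_ne_induct)
  case (insert a S)
  define p where "p i = (\<Prod>j\<in>S - {i}. z i - z j)" for i
  have za: "z a \<notin> z ` S" using insert.prems insert.hyps by (auto simp: inj_on_def)
  have ya: "y \<noteq> z a" using insert.prems by auto
  have IH: "1 / (\<Prod>i\<in>S. x - z i) = (\<Sum>i\<in>S. 1 / ((x - z i) * p i))" if "x \<notin> z ` S" for x
    using insert that by (simp add: p_def)
  have "(\<Sum>i\<in>S. 1 / ((y - z i) * (\<Prod>j\<in>insert a S - {i}. z i - z j))) =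
      (\<Sum>i\<in>S. 1 / (y - z a) * (1 / ((y - z i) * p i) - 1 / ((z a - z i) * p i)))"
  proof (intro sum.cong refl)
    fix i assume i: "i \<in> S"
    then have "insert a S - {i} = insert a (S - {i})" using insert.hyps by auto
    then have "(\<Prod>j\<in>insert a S - {i}. z i - z j) = (z i - z a) * p i"
      using insert.hyps by (simp add: p_def)
    moreover have "p i \<noteq> 0"
      using i insert.hyps insert.prems by (auto simp: p_def inj_on_def)
    moreover have "y \<noteq> z i" "z a \<noteq> z i"
      using i insert.prems za by (blast intro: image_eqI)+
    then have "y - z i \<noteq> 0" "y - z a \<noteq> 0" "z a - z i \<noteq> 0" "z i - z a \<noteq> 0"
      using ya by auto
    moreover have "(y - z a) * (z a - z i) = (z a - y) * (z i - z a)"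
      by algebra
    ultimately show "1 / ((y - z i) * (\<Prod>j\<in>insert a S - {i}. z i - z j)) =
        1 / (y - z a) * (1 / ((y - z i) * p i) - 1 / ((z a - z i) * p i))"
      by (simp add: divide_simps)
  qed
  also have "\<dots> = 1 / (y - z a) * (1 / (\<Prod>i\<in>S. y - z i) - 1 / (\<Prod>i\<in>S. z a - z i))"
    using insert.prems by (simp add: IH[OF za] IH sum_subtractf flip: sum_distrib_left sum_divide_distrib)
  finally have "(\<Sum>i\<in>S. 1 / ((y - z i) * (\<Prod>j\<in>insert a S - {i}. z i - z j))) =
      1 / (y - z a) * (1 / (\<Prod>i\<in>S. y - z i) - 1 / (\<Prod>i\<in>S. z a - z i))" .
  \<comment> \<open>The summand for \<open>a\<close> cancels the term that comes from evaluating at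
    \<open>z a\<close>.\<close>
  moreover have "insert a S - {a} = S" using insert.hyps by auto
  ultimately show ?case
    using insert.hyps by (simp add: right_diff_distrib)
qed simp

section \<open>The residue formula\<close>

text \<open>The unramified case, for any G that reduces to a power of y at t = 0; this form also
  fits y^r - t^N H(t^N, y). The link to the derivative is that it takes the value \<open>d i\<close>
  times U(t, Y_i) at the root.\<close>

lemma CT_y_eq_sum_roots:
  fixes G F :: "'a::field fps fps" and Y :: "'b \<Rightarrow> 'a fps"
  assumes S: "finite S" "inj_on Y S" "S \<noteq> {}" and G0: "fps_nth G 0 = fps_X ^ card S"
    and Y0: "\<And>i. i \<in> S \<Longrightarrow> fps_nth (Y i) 0 = 0"
    and root: "\<And>i. i \<in> S \<Longrightarrow> subst_xy 1 (Y i) G = 0"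
  shows "CT_y (iter_laurent var_y / iter_laurent G * iter_laurent F) =
    (\<Sum>i\<in>S. fps_to_fls (subst_xy 1 (Y i) F) / fps_to_fls (subst_xy 1 (Y i) (deriv_y G)))"
proof -
  define d where "d i = (\<Prod>j\<in>S - {i}. Y i - Y j)" for i
  have d: "d i \<noteq> 0" if "i \<in> S" for i
    using that S by (auto simp: d_def inj_on_def)
  obtain U where U: "G = (\<Prod>i\<in>S. root_factor (Y i)) * U"
    using prod_root_factor_dvd[OF S(1,2) Y0 root] by (auto elim: dvdE)
  have "fps_nth (\<Prod>i\<in>S. root_factor (Y i)) 0 = (\<Prod>i\<in>S. fps_nth (root_factor (Y i)) 0)"
    by (induction S rule: infinite_finite_induct) simp_all
  also have "\<dots> = fps_X ^ card S"
    using Y0 by (simp add: root_factor_def)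
  \<comment> \<open>At t = 0 each linear factor becomes y, so both \<open>G\<close> and the product
    become y^|S|, which can be cancelled.\<close>
  finally have "fps_nth U 0 = 1"
    using G0 by (simp add: U)
  \<comment> \<open>The inverse of \<open>U\<close> is a power series in both variables, so
    \<open>F * V\<close> can stand in for \<open>F\<close> in
    \<open>CT_y_root_factor\<close>.\<close>
  then obtain V where V: "U * V = 1"
    using fps_right_inverse[of U 1] by auto

  let ?y = "iter_laurent var_y" and ?z = "\<lambda>i. iter_laurent (outer_const (Y i))"
  have y_z: "?y - ?z i = iter_laurent (root_factor (Y i))" for i
    by (simp add: root_factor_def iter_laurent_diff)
  have prod_z: "(\<Prod>j\<in>S - {i}. ?z i - ?z j) = iter_laurent (outer_const (d i))" for i
    by (simp add: d_def outer_const_prod iter_laurent_prod outer_const_diff iter_laurent_diff)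
  have "inj_on ?z S"
  proof (rule inj_onI)
    fix i j assume "i \<in> S" "j \<in> S" "?z i = ?z j"
    then have "iter_laurent (outer_const (Y i - Y j)) = 0"
      by (simp add: outer_const_diff iter_laurent_diff)
    then show "i = j" using S(2) \<open>i \<in> S\<close> \<open>j \<in> S\<close> by (auto simp: inj_on_def)
  qed
  moreover have "?y \<notin> ?z ` S"
  proof
    assume "?y \<in> ?z ` S"
    then obtain i where "?y - ?z i = 0" by auto
    then show False by (simp only: y_z iter_laurent_eq_0_iff root_factor_nonzero)
  qed
  ultimately have pf: "1 / (\<Prod>i\<in>S. iter_laurent (root_factor (Y i))) =
      (\<Sum>i\<in>S. 1 / (iter_laurent (root_factor (Y i)) * iter_laurent (outer_const (d i))))"
    using partial_fractions[OF S(1,3), of ?z ?y] unfolding y_z prod_z by blast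
  have UV: "iter_laurent U * iter_laurent V = 1"
    by (simp add: V flip: iter_laurent_mult)
  have "U \<noteq> 0" using V by auto
  then have "1 / iter_laurent U = iter_laurent V"
    using UV by (simp add: field_simps)
  moreover have "?y / iter_laurent G * iter_laurent F =
      ?y * (1 / (\<Prod>i\<in>S. iter_laurent (root_factor (Y i)))) * (1 / iter_laurent U) * iter_laurent F"
    by (simp add: U iter_laurent_mult iter_laurent_prod)
  ultimately have "?y / iter_laurent G * iter_laurent F =
      (\<Sum>i\<in>S. ?y / iter_laurent (root_factor (Y i)) * iter_laurent (F * V) /
        iter_laurent (outer_const (d i)))"
    by (simp add: pf iter_laurent_mult sum_distrib_left sum_distrib_right mult_ac)
  then have "CT_y (?y / iter_laurent G * iter_laurent F) =
      (\<Sum>i\<in>S. fps_to_fls (subst_xy 1 (Y i) (F * V)) / fps_to_fls (d i))"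
    by (simp only: CT_y_sum) (intro sum.cong refl, simp only: CT_y_divide_outer_const[OF d] CT_y_root_factor[OF Y0])
  also have "\<dots> = (\<Sum>i\<in>S. fps_to_fls (subst_xy 1 (Y i) F) / fps_to_fls (subst_xy 1 (Y i) (deriv_y G)))"
  proof (intro sum.cong refl)
    fix i assume i: "i \<in> S"
    let ?ev = "subst_xy 1 (Y i)"
    \<comment> \<open>With the factor of the i-th root isolated, the derivative at this root is the
      value of the cofactor.\<close>
    have "G = root_factor (Y i) * ((\<Prod>j\<in>S - {i}. root_factor (Y j)) * U)"
      using S(1) i by (simp add: U prod.remove mult_ac)
    then have "?ev (deriv_y G) = d i * ?ev U"
      using Y0[OF i]
      by (simp only: subst_xy_deriv_y_root subst_xy_mult subst_xy_prod subst_xy_root_factor d_def order.refl)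
    moreover have "?ev U * ?ev V = 1"
      using Y0[OF i] V by (simp only: subst_xy_1 order.refl flip: subst_xy_mult)
    moreover have "?ev (F * V) = ?ev F * ?ev V"
      using Y0[OF i] by (simp only: subst_xy_mult order.refl)
    moreover from calculation have "?ev U \<noteq> 0" by auto
    ultimately show "fps_to_fls (?ev (F * V)) / fps_to_fls (d i) =
        fps_to_fls (?ev F) / fps_to_fls (?ev (deriv_y G))"
      using d[OF i] by (simp add: divide_simps mult_ac flip: fls_times_fps_to_fls)
  qed
  finally show ?thesis .
qed

section \<open>Replacing x by t^N in Laurent series\<close>

lemma fls_compose_power_divide:
  fixes f g :: "'a::field fls"
  assumes "N > 0"
  shows "fls_compose_power (f / g) N = fls_compose_power f N / fls_compose_power g N"
proof (cases "g = 0")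
  case False
  then have eq: "fls_compose_power (f / g) N * fls_compose_power g N = fls_compose_power f N"
    by (simp flip: fls_compose_power_mult)
  \<comment> \<open>The image of the inverse of \<open>g\<close> witnesses that the image of
    \<open>g\<close> is nonzero.\<close>
  have "fls_compose_power (1 / g) N * fls_compose_power g N = 1"
    using False assms by (simp flip: fls_compose_power_mult)
  then have "fls_compose_power g N \<noteq> 0" by auto
  then show ?thesis using eq by (simp add: field_simps)
qed simp

lemma fls_compose_power_iter_laurent:
  assumes "N > 0"
  shows "fls_compose_power (iter_laurent F) N = iter_laurent (fps_compose F (fps_X ^ N))"
  unfolding iter_laurent_def fls_compose_power_fps_to_fls[OF assms]
  by (intro arg_cong[where f = fps_to_fls] fps_ext) (simp add: fps_nth_compose_X_power)

text \<open>The substitution only moves coefficients in the outer variable, whereas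
  \<open>CT_y\<close> acts inside each coefficient.\<close>

lemma fls_compose_power_CT_y:
  assumes "N > 0"
  shows "fls_compose_power (CT_y f) N = CT_y (fls_compose_power f N)"
  by (rule fls_eqI) (simp add: fls_nth_CT_y fls_nth_compose_power[OF assms])

lemma deriv_y_compose_X_power:
  "deriv_y (fps_compose F (fps_X ^ N)) = fps_compose (deriv_y F) (fps_X ^ N)"
  by (rule fps_ext) (simp add: fps_nth_compose_X_power)

text \<open>The constant term lies in K((x)) and the sum over the roots in K((t));
  \<open>fls_compose_power\<close> with exponent N is the inclusion of the former into the latter
  given by x = t^N.\<close>

theorem mainTheorem12:
  fixes H \<Phi> :: "'a::field_char_0 fps fps" and Y :: "nat \<Rightarrow> 'a fps" and r N :: nat
  assumes "r \<ge> 1" and "N \<ge> 1"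
    and "\<And>i. i \<in> {1..r} \<Longrightarrow> positive_root N (var_y ^ r - var_x * H) (Y i)"
    and "inj_on Y {1..r}"
  shows "fls_compose_power
      (CT_y (iter_laurent var_y / iter_laurent (var_y ^ r - var_x * H) * iter_laurent \<Phi>)) N =
    (\<Sum>i = 1..r. fps_to_fls (subst_xy N (Y i) \<Phi>) /
      fps_to_fls (subst_xy N (Y i) (of_nat r * var_y ^ (r - 1) - var_x * deriv_y H)))"
proof -
  define G where "G = var_y ^ r - var_x * H"
  let ?c = "\<lambda>F. fps_compose F (fps_X ^ N)"
  have N: "N > 0" using assms(2) by simp
  have deriv: "deriv_y G = of_nat r * var_y ^ (r - 1) - var_x * deriv_y H"
    by (rule fps_ext) (simp add: G_def fps_deriv_power fps_const_power fps_of_nat[symmetric] del: fps_of_nat)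
  have "fls_compose_power (CT_y (iter_laurent var_y / iter_laurent G * iter_laurent \<Phi>)) N =
      CT_y (iter_laurent (?c var_y) / iter_laurent (?c G) * iter_laurent (?c \<Phi>))"
    using N by (simp add: fls_compose_power_CT_y fls_compose_power_divide fls_compose_power_iter_laurent)
  also have "?c var_y = var_y"
    by simp
  also have "CT_y (iter_laurent var_y / iter_laurent (?c G) * iter_laurent (?c \<Phi>)) =
      (\<Sum>i = 1..r. fps_to_fls (subst_xy 1 (Y i) (?c \<Phi>)) /
        fps_to_fls (subst_xy 1 (Y i) (deriv_y (?c G))))"
  proof (rule CT_y_eq_sum_roots)
    \<comment> \<open>The summand x H has no term of degree 0 in x, so only y^r survives.\<close>
    show "fps_nth (?c G) 0 = fps_X ^ card {1..r}"
      by (simp add: fps_nth_compose_X_power G_def fps_const_power)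
    show "fps_nth (Y i) 0 = 0" "subst_xy 1 (Y i) (?c G) = 0" if "i \<in> {1..r}" for i
      using assms(3)[OF that]
      by (simp_all only: positive_root_def G_def subst_xy_eq_subst_xy_1[OF assms(2)])
  qed (use assms(1,4) in auto)
  \<comment> \<open>Since the derivative in y commutes with x = t^N, both evaluations on the right
    turn back into \<open>subst_xy N\<close>.\<close>
  finally show ?thesis
    by (simp only: G_def[symmetric] deriv[symmetric] deriv_y_compose_X_power
        subst_xy_eq_subst_xy_1[OF assms(2)])
qed

end
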